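(* Let $\mathbb{D}$ be a small category, $\mathsf{K}$ an order enriched category and $J$ a subcategory containing all objects of $\mathsf{K}$, such that $J$ and $\mathsf{K}$ have coproducts of all families indexed by objects of $\mathbb{D}$ preserved by $J\hookrightarrow\mathsf{K}$, $\mathsf{K}$ is left distributive $\mathsf{DCpo}^\vee$-enriched, and cotupling preserves the order. Then for every $\pi\in[\mathbb{D},\mathsf{K}]^J$, $$\Sigma_!(\pi)=\mu x.\Big(id_{\sum_D\pi(D)}\vee\bigvee_{d:D_1\to D_2\in\mathbb{D}}x\circ\overline{\pi(d)}\Big),$$ the least fixed point of the map $x\mapsto id\vee\bigvee_{d}x\circ\overline{\pi(d)}$ on $\mathsf{K}(\sum_D\pi(D),\sum_D\pi(D))$.
   Context: Lax functors $\pi:\mathbb{D}\to\mathsf{K}$ satisfy $id_{\pi D}\leq\pi(id_D)$, $\pi(d_1)\circ\pi(d_2)\leq\pi(d_1\circ d_2)$; $[\mathbb{D},\mathsf{K}]^J$ consists of lax functors and oplax transformations with components in $J$. $\mathsf{DCpo}^\vee$-enriched: hom-sets have binary joins and directed suprema, composition monotone and preserving directed suprema in each variable; left distributive: $h\circ(f\vee g)=h\circ f\vee h\circ g$; cotupling preserves order: $f_i\leq g_i$ for all $i$ implies $[f_i]\leq[g_i]$. For $\pi$, $X=\sum_{D}\pi(D)$ with coprojections $\mathsf{in}_{\pi D}$; for $d:D_1\to D_2$, $\overline{\pi(d)}=[\delta_D]_D:X\to X$ with $\delta_{D_1}=\mathsf{in}_{\pi D_2}\circ\pi(d)$ and $\delta_D=\mathsf{in}_{\pi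 D}$ for $D\neq D_1$. $\Pi=\{\overline{\pi(d_1)}\vee\dots\vee\overline{\pi(d_k)}\mid k\geq1,\ d_i\in\mathbb{D}\}$ and $\Sigma_!(\pi)=\bigvee_{l\in\mathbb{N}}(\bigvee\Pi)^l$. The join $\bigvee_{d}x\circ\overline{\pi(d)}$ over all morphisms $d$ of $\mathbb{D}$ means the supremum of the directed set of finite joins of the $x\circ\overline{\pi(d)}$. *)

theory Defs
  imports "HOL-Algebra.Complete_Lattice"
begin

section \<open>Categories\<close>

record ('o, 'm) category =
  Obj :: "'o set"
  Arr :: "'m set"
  Dom :: "'m \<Rightarrow> 'o"
  Cod :: "'m \<Rightarrow> 'o"
  Ident :: "'o \<Rightarrow> 'm"
  Comp :: "'m \<Rightarrow> 'm \<Rightarrow> 'm"  (infixl \<open>\<cdot>\<index>\<close> 75)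

definition Hom :: "('o, 'm, 'z) category_scheme \<Rightarrow> 'o \<Rightarrow> 'o \<Rightarrow> 'm set" where
  "Hom C A B = {f \<in> Arr C. Dom C f = A \<and> Cod C f = B}"

locale category =
  fixes C :: "('o, 'm, 'z) category_scheme" (structure)
  assumes Dom_Obj: "f \<in> Arr C \<Longrightarrow> Dom C f \<in> Obj C"
    and Cod_Obj: "f \<in> Arr C \<Longrightarrow> Cod C f \<in> Obj C"
    and Ident_Hom: "A \<in> Obj C \<Longrightarrow> Ident C A \<in> Hom C A A"
    and Comp_Hom: "\<lbrakk>f \<in> Hom C A B; g \<in> Hom C B E\<rbrakk> \<Longrightarrow> g \<cdot> f \<in> Hom C A E"
    and Comp_Ident: "f \<in> Hom C A B \<Longrightarrow> f \<cdot> Ident C A = f"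
    and Ident_Comp: "f \<in> Hom C A B \<Longrightarrow> Ident C B \<cdot> f = f"
    and Comp_assoc: "\<lbrakk>f \<in> Hom C A B; g \<in> Hom C B E; h \<in> Hom C E F\<rbrakk> \<Longrightarrow>
      (h \<cdot> g) \<cdot> f = h \<cdot> (g \<cdot> f)"

definition subcategory ::
    "('o, 'm, 'y) category_scheme \<Rightarrow> ('o, 'm, 'z) category_scheme \<Rightarrow> bool" where
  "subcategory J K \<longleftrightarrow>
     category J \<and> category K \<and> Obj J \<subseteq> Obj K \<and> Arr J \<subseteq> Arr K \<and>
     (\<forall>f\<in>Arr J. Dom J f = Dom K f \<and> Cod J f = Cod K f) \<and>
     (\<forall>A\<in>Obj J. Ident J A = Ident K A) \<and>
     (\<forall>f\<in>Arr J. \<forall>g\<in>Arr J. Cod J f = Dom J g \<longrightarrow> g \<cdot>\<^bsub>J\<^esub> f = g \<cdot>\<^bsub>K\<^esub> f)"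


section \<open>Coproducts\<close>

definition is_coproduct ::
    "('o, 'm, 'z) category_scheme \<Rightarrow> 'i set \<Rightarrow> ('i \<Rightarrow> 'o) \<Rightarrow> 'o \<Rightarrow> ('i \<Rightarrow> 'm) \<Rightarrow> bool" where
  "is_coproduct C I A X \<iota> \<longleftrightarrow>
     (\<forall>i\<in>I. A i \<in> Obj C) \<and> X \<in> Obj C \<and> (\<forall>i\<in>I. \<iota> i \<in> Hom C (A i) X) \<and>
     (\<forall>Y\<in>Obj C. \<forall>f. (\<forall>i\<in>I. f i \<in> Hom C (A i) Y) \<longrightarrow>
        (\<exists>!h. h \<in> Hom C X Y \<and> (\<forall>i\<in>I. h \<cdot>\<^bsub>C\<^esub> \<iota> i = f i)))"

text \<open>The cotuple \<open>[f i]\<^sub>i : X \<rightarrow> Y\<close> of a family of morphisms \<open>f i : A i \<rightarrow> Y\<close>.\<close>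

definition cotuple ::
    "('o, 'm, 'z) category_scheme \<Rightarrow> 'i set \<Rightarrow> 'o \<Rightarrow> ('i \<Rightarrow> 'm) \<Rightarrow> 'o \<Rightarrow> ('i \<Rightarrow> 'm) \<Rightarrow> 'm" where
  "cotuple C I X \<iota> Y f = (THE h. h \<in> Hom C X Y \<and> (\<forall>i\<in>I. h \<cdot>\<^bsub>C\<^esub> \<iota> i = f i))"

definition has_coproducts :: "('o, 'm, 'z) category_scheme \<Rightarrow> 'i set \<Rightarrow> bool" where
  "has_coproducts C I \<longleftrightarrow>
     (\<forall>A. (\<forall>i\<in>I. A i \<in> Obj C) \<longrightarrow> (\<exists>X \<iota>. is_coproduct C I A X \<iota>))"

definition inclusion_preserves_coproducts ::
    "('o, 'm, 'y) category_scheme \<Rightarrow> ('o, 'm, 'z) category_scheme \<Rightarrow> 'i set \<Rightarrow> bool" where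
  "inclusion_preserves_coproducts J K I \<longleftrightarrow>
     (\<forall>A X \<iota>. is_coproduct J I A X \<iota> \<longrightarrow> is_coproduct K I A X \<iota>)"


section \<open>Order enrichment\<close>

record ('o, 'm) ord_category = "('o, 'm) category" +
  Leq :: "'m \<Rightarrow> 'm \<Rightarrow> bool"

definition hom_poset :: "('o, 'm, 'z) ord_category_scheme \<Rightarrow> 'o \<Rightarrow> 'o \<Rightarrow> 'm gorder" where
  "hom_poset K A B = \<lparr>carrier = Hom K A B, eq = (=), le = Leq K\<rparr>"

locale order_enriched_category = category K
  for K :: "('o, 'm, 'z) ord_category_scheme" (structure) +
  assumes hom_partial_order: "\<lbrakk>A \<in> Obj K; B \<in> Obj K\<rbrakk> \<Longrightarrow> partial_order (hom_poset K A B)"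
    and Comp_mono: "\<lbrakk>f \<in> Hom K A B; f' \<in> Hom K A B; g \<in> Hom K B C; g' \<in> Hom K B C;
      Leq K f f'; Leq K g g'\<rbrakk> \<Longrightarrow> Leq K (g \<cdot> f) (g' \<cdot> f')"

definition directed_in :: "('a, 'z) gorder_scheme \<Rightarrow> 'a set \<Rightarrow> bool" where
  "directed_in L S \<longleftrightarrow> S \<noteq> {} \<and> S \<subseteq> carrier L \<and>
     (\<forall>x\<in>S. \<forall>y\<in>S. \<exists>z\<in>S. x \<sqsubseteq>\<^bsub>L\<^esub> z \<and> y \<sqsubseteq>\<^bsub>L\<^esub> z)"

locale dcpo_join_enriched_category = order_enriched_category K
  for K :: "('o, 'm, 'z) ord_category_scheme" (structure) +
  assumes join_exists: "\<lbrakk>f \<in> Hom K A B; g \<in> Hom K A B\<rbrakk> \<Longrightarrow>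
      \<exists>s. least (hom_poset K A B) s (Upper (hom_poset K A B) {f, g})"
    and directed_sup_exists: "directed_in (hom_poset K A B) S \<Longrightarrow>
      \<exists>s. least (hom_poset K A B) s (Upper (hom_poset K A B) S)"
    and Comp_directed_sup_right: "\<lbrakk>directed_in (hom_poset K A B) S; h \<in> Hom K B C\<rbrakk> \<Longrightarrow>
      h \<cdot> (\<Squnion>\<^bsub>hom_poset K A B\<^esub> S) = \<Squnion>\<^bsub>hom_poset K A C\<^esub> ((\<lambda>f. h \<cdot> f) ` S)"
    and Comp_directed_sup_left: "\<lbrakk>f \<in> Hom K A B; directed_in (hom_poset K B C) S\<rbrakk> \<Longrightarrow>
      (\<Squnion>\<^bsub>hom_poset K B C\<^esub> S) \<cdot> f = \<Squnion>\<^bsub>hom_poset K A C\<^esub> ((\<lambda>h. h \<cdot> f) ` S)"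

definition left_distributive :: "('o, 'm, 'z) ord_category_scheme \<Rightarrow> bool" where
  "left_distributive K \<longleftrightarrow>
     (\<forall>A B C. \<forall>f\<in>Hom K A B. \<forall>g\<in>Hom K A B. \<forall>h\<in>Hom K B C.
        h \<cdot>\<^bsub>K\<^esub> (f \<squnion>\<^bsub>hom_poset K A B\<^esub> g) =
          (h \<cdot>\<^bsub>K\<^esub> f) \<squnion>\<^bsub>hom_poset K A C\<^esub> (h \<cdot>\<^bsub>K\<^esub> g))"

definition cotupling_preserves_order :: "('o, 'm, 'z) ord_category_scheme \<Rightarrow> 'i set \<Rightarrow> bool" where
  "cotupling_preserves_order K I \<longleftrightarrow>
     (\<forall>A X \<iota> Y f g. is_coproduct K I A X \<iota> \<and> Y \<in> Obj K \<and>
        (\<forall>i\<in>I. f i \<in> Hom K (A i) Y \<and> g i \<in> Hom K (A i) Y \<and> Leq K (f i) (g i)) \<longrightarrow>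
        Leq K (cotuple K I X \<iota> Y f) (cotuple K I X \<iota> Y g))"


section \<open>Lax functors\<close>

text \<open>The source of a lax functor is an ordinary category, regarded as discretely ordered, so
  there is no monotonicity condition.\<close>

record ('d, 'e, 'o, 'm) functor_data =
  FObj :: "'d \<Rightarrow> 'o"
  FArr :: "'e \<Rightarrow> 'm"

definition lax_functor ::
    "('d, 'e, 'y) category_scheme \<Rightarrow> ('o, 'm, 'z) ord_category_scheme \<Rightarrow>
     ('d, 'e, 'o, 'm) functor_data \<Rightarrow> bool" where
  "lax_functor D K \<pi> \<longleftrightarrow>
     (\<forall>A\<in>Obj D. FObj \<pi> A \<in> Obj K) \<and>
     (\<forall>d\<in>Arr D. FArr \<pi> d \<in> Hom K (FObj \<pi> (Dom D d)) (FObj \<pi> (Cod D d))) \<and>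
     (\<forall>A\<in>Obj D. Leq K (Ident K (FObj \<pi> A)) (FArr \<pi> (Ident D A))) \<and>
     (\<forall>d1\<in>Arr D. \<forall>d2\<in>Arr D. Cod D d2 = Dom D d1 \<longrightarrow>
        Leq K (FArr \<pi> d1 \<cdot>\<^bsub>K\<^esub> FArr \<pi> d2) (FArr \<pi> (d1 \<cdot>\<^bsub>D\<^esub> d2)))"


section \<open>Saturation\<close>

text \<open>Joins of nonempty finite families of elements of \<open>S\<close>, and the join of an arbitrary family
  taken as the supremum of these.\<close>

definition finite_joins :: "('a, 'z) gorder_scheme \<Rightarrow> 'a set \<Rightarrow> 'a set" where
  "finite_joins L S = {\<Squnion>\<^bsub>L\<^esub> F | F. finite F \<and> F \<noteq> {} \<and> F \<subseteq> S}"

definition join_of :: "('a, 'z) gorder_scheme \<Rightarrow> 'a set \<Rightarrow> 'a" where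
  "join_of L S = \<Squnion>\<^bsub>L\<^esub> (finite_joins L S)"

text \<open>In the following, \<open>X\<close> with coprojections \<open>\<iota>\<close> is a coproduct in \<open>K\<close> of the objects
  \<open>FObj \<pi> A\<close>, with \<open>A\<close> ranging over \<open>Obj D\<close>.\<close>

definition lift_arr ::
    "('d, 'e, 'y) category_scheme \<Rightarrow> ('o, 'm, 'z) ord_category_scheme \<Rightarrow>
     ('d, 'e, 'o, 'm) functor_data \<Rightarrow> 'o \<Rightarrow> ('d \<Rightarrow> 'm) \<Rightarrow> 'e \<Rightarrow> 'm" where
  "lift_arr D K \<pi> X \<iota> d =
     cotuple K (Obj D) X \<iota> X
       (\<lambda>A. if A = Dom D d then \<iota> (Cod D d) \<cdot>\<^bsub>K\<^esub> FArr \<pi> d else \<iota> A)"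

definition Pi_set ::
    "('d, 'e, 'y) category_scheme \<Rightarrow> ('o, 'm, 'z) ord_category_scheme \<Rightarrow>
     ('d, 'e, 'o, 'm) functor_data \<Rightarrow> 'o \<Rightarrow> ('d \<Rightarrow> 'm) \<Rightarrow> 'm set" where
  "Pi_set D K \<pi> X \<iota> = finite_joins (hom_poset K X X) (lift_arr D K \<pi> X \<iota> ` Arr D)"

definition endo_power :: "('o, 'm, 'z) category_scheme \<Rightarrow> 'o \<Rightarrow> 'm \<Rightarrow> nat \<Rightarrow> 'm" where
  "endo_power C X f l = ((\<lambda>g. f \<cdot>\<^bsub>C\<^esub> g) ^^ l) (Ident C X)"

definition Sigma_bang ::
    "('d, 'e, 'y) category_scheme \<Rightarrow> ('o, 'm, 'z) ord_category_scheme \<Rightarrow>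
     ('d, 'e, 'o, 'm) functor_data \<Rightarrow> 'o \<Rightarrow> ('d \<Rightarrow> 'm) \<Rightarrow> 'm" where
  "Sigma_bang D K \<pi> X \<iota> =
     \<Squnion>\<^bsub>hom_poset K X X\<^esub>
       (range (endo_power K X (\<Squnion>\<^bsub>hom_poset K X X\<^esub> (Pi_set D K \<pi> X \<iota>))))"

end

theory Submission
  imports Defs
begin

text \<open>Write \<open>P\<close> for the join of all \<open>lift_arr D K \<pi> X \<iota> d\<close>. Left distributivity together with
  continuity of composition turns the join of the \<open>x \<cdot> lift_arr D K \<pi> X \<iota> d\<close> into \<open>x \<cdot> P\<close>, and
  laxness at an identity arrow together with monotonicity of cotupling gives \<open>Ident K X \<le> P\<close>. Hence
  the powers of \<open>P\<close> form an ascending chain, whose supremum is the least solution of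
  \<open>x = Ident K X \<squnion> x \<cdot> P\<close>. If \<open>D\<close> has no objects, then the joins over its arrows are suprema of
  the empty set, but then \<open>X\<close> is initial and has only one endomorphism.\<close>

section \<open>Joins in ordered sets\<close>

text \<open>\<open>sup\<close> is a Hilbert choice, so it is a least upper bound only once some
  least upper bound is known to exist. The lemma serves directed sets and, later, the empty
  set.\<close>

lemma least_sup:
  fixes L (structure)
  assumes "\<exists>s. least L s (Upper L S)"
  shows "least L (\<Squnion>S) (Upper L S)"
  using assms unfolding sup_def by (rule someI_ex)

context upper_semilattice
begin

lemma finite_sup_upper:
  assumes "finite F" "F \<subseteq> carrier L" "x \<in> F"
  shows "x \<sqsubseteq> \<Squnion>F"
  using least_Upper_above[OF finite_sup_least] assms by blast

lemma finite_sup_below: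
  assumes "finite F" "F \<subseteq> carrier L" "F \<noteq> {}" "y \<in> carrier L" "\<And>x. x \<in> F \<Longrightarrow> x \<sqsubseteq> y"
  shows "\<Squnion>F \<sqsubseteq> y"
  by (rule least_le[OF finite_sup_least]) (use assms in \<open>auto intro: Upper_memI\<close>)

text \<open>Reduces finite joins to binary joins, the ones of which left distributivity
  speaks.\<close>

lemma finite_sup_insert:
  assumes "finite F" "F \<noteq> {}" "F \<subseteq> carrier L" "x \<in> carrier L"
  shows "\<Squnion>(insert x F) = x \<squnion> \<Squnion>F"
proof (rule le_antisym)
  have F: "\<Squnion>F \<in> carrier L" and I: "\<Squnion>(insert x F) \<in> carrier L"
    using assms by (auto intro!: finite_sup_closed)
  show "\<Squnion>(insert x F) \<sqsubseteq> x \<squnion> \<Squnion>F"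
  proof (rule finite_sup_below)
    fix y assume "y \<in> insert x F"
    then show "y \<sqsubseteq> x \<squnion> \<Squnion>F"
    proof
      assume "y \<in> F"
      then have "y \<sqsubseteq> \<Squnion>F" using assms by (intro finite_sup_upper)
      then show ?thesis
        using \<open>y \<in> F\<close> assms F by (meson join_closed join_right le_trans subsetD)
    qed (use assms F in \<open>simp add: join_left\<close>)
  qed (use assms F in auto)
  show "x \<squnion> \<Squnion>F \<sqsubseteq> \<Squnion>(insert x F)"
    by (intro join_le finite_sup_below finite_sup_upper) (use assms F I in auto)
qed (use assms in \<open>auto intro!: finite_sup_closed join_closed\<close>)

lemma finite_joins_closed:
  assumes "S \<subseteq> carrier L"
  shows "finite_joins L S \<subseteq> carrier L"
  using assms unfolding finite_joins_def by (blast intro: finite_sup_closed)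

lemma finite_joins_superset:
  assumes "S \<subseteq> carrier L"
  shows "S \<subseteq> finite_joins L S"
proof
  fix x assume "x \<in> S"
  then have "\<Squnion>{x} = x" using assms weak_sup_of_singleton eq_is_equal by auto
  then show "x \<in> finite_joins L S"
    using \<open>x \<in> S\<close> unfolding finite_joins_def by (intro CollectI exI[of _ "{x}"]) auto
qed

text \<open>The union of two finite index sets yields an upper bound of the two joins. Directedness
  makes the supremum in \<open>join_of\<close> exist and lets composition preserve it.\<close>

lemma directed_finite_joins:
  assumes "S \<subseteq> carrier L" "S \<noteq> {}"
  shows "directed_in L (finite_joins L S)"
  unfolding directed_in_def
proof (intro conjI ballI)
  show "finite_joins L S \<noteq> {}" using assms finite_joins_superset by blast
  show "finite_joins L S \<subseteq> carrier L" using assms(1) by (rule finite_joins_closed)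
  fix x y assume "x \<in> finite_joins L S" "y \<in> finite_joins L S"
  then obtain F G where F: "x = \<Squnion>F" "finite F" "F \<noteq> {}" "F \<subseteq> S"
    and G: "y = \<Squnion>G" "finite G" "G \<noteq> {}" "G \<subseteq> S"
    unfolding finite_joins_def by blast
  have FG: "finite (F \<union> G)" "F \<union> G \<subseteq> carrier L" "F \<union> G \<noteq> {}" using F G assms by auto
  have "x \<sqsubseteq> \<Squnion>(F \<union> G)" "y \<sqsubseteq> \<Squnion>(F \<union> G)"
    unfolding F(1) G(1)
    by (intro finite_sup_below finite_sup_upper finite_sup_closed; use F G FG in auto)+
  moreover have "\<Squnion>(F \<union> G) \<in> finite_joins L S" using F G FG unfolding finite_joins_def by blast
  ultimately show "\<exists>z\<in>finite_joins L S. x \<sqsubseteq> z \<and> y \<sqsubseteq> z" by blast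
qed

end

section \<open>Coproducts and cotuples\<close>

lemma is_coproduct_Ex1:
  assumes "is_coproduct C I A X \<iota>" "Y \<in> Obj C" "\<And>i. i \<in> I \<Longrightarrow> f i \<in> Hom C (A i) Y"
  shows "\<exists>!h. h \<in> Hom C X Y \<and> (\<forall>i\<in>I. h \<cdot>\<^bsub>C\<^esub> \<iota> i = f i)"
  using assms unfolding is_coproduct_def by blast

lemma cotuple_Hom:
  assumes "is_coproduct C I A X \<iota>" "Y \<in> Obj C" "\<And>i. i \<in> I \<Longrightarrow> f i \<in> Hom C (A i) Y"
  shows "cotuple C I X \<iota> Y f \<in> Hom C X Y"
  using theI'[OF is_coproduct_Ex1[OF assms]] unfolding cotuple_def by blast

lemma cotuple_mono:
  assumes "cotupling_preserves_order K I" "is_coproduct K I A X \<iota>" "Y \<in> Obj K"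
    and "\<And>i. i \<in> I \<Longrightarrow> f i \<in> Hom K (A i) Y"
    and "\<And>i. i \<in> I \<Longrightarrow> g i \<in> Hom K (A i) Y"
    and "\<And>i. i \<in> I \<Longrightarrow> Leq K (f i) (g i)"
  shows "Leq K (cotuple K I X \<iota> Y f) (cotuple K I X \<iota> Y g)"
  using assms(1)[unfolded cotupling_preserves_order_def, rule_format, of A X \<iota> Y f g] assms(2-)
  by simp

text \<open>The identity solves the equations that determine this cotuple. In this form it can be
  compared with \<open>lift_arr\<close> by monotonicity of cotupling.\<close>

lemma (in category) cotuple_coprojections:
  assumes "is_coproduct C I A X \<iota>"
  shows "cotuple C I X \<iota> X \<iota> = Ident C X"
proof -
  have "X \<in> Obj C" and \<iota>: "\<And>i. i \<in> I \<Longrightarrow> \<iota> i \<in> Hom C (A i) X"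
    using assms unfolding is_coproduct_def by auto
  then show ?thesis
    unfolding cotuple_def
    by (intro the1_equality[OF is_coproduct_Ex1[OF assms]]) (auto intro: Ident_Hom Ident_Comp)
qed

section \<open>Joins of morphisms\<close>

lemma hom_poset_simps [simp]:
  "carrier (hom_poset K A B) = Hom K A B"
  "le (hom_poset K A B) = Leq K"
  "eq (hom_poset K A B) = (=)"
  by (simp_all add: hom_poset_def)

lemma (in category) Hom_Obj:
  assumes "f \<in> Hom C A B"
  shows "A \<in> Obj C" "B \<in> Obj C"
  using assms Dom_Obj Cod_Obj unfolding Hom_def by auto

context dcpo_join_enriched_category
begin

lemma upper_semilattice_hom:
  assumes "A \<in> Obj K" "B \<in> Obj K"
  shows "upper_semilattice (hom_poset K A B)"
proof -
  interpret partial_order "hom_poset K A B" using assms by (rule hom_partial_order)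
  show ?thesis by unfold_locales (simp add: join_exists)
qed

lemmas least_directed_sup = least_sup[OF directed_sup_exists]

text \<open>Induction extends binary left distributivity to finite joins. It starts at singletons,
  since nothing is assumed about empty joins.\<close>

lemma Comp_finite_sup:
  assumes "left_distributive K" "h \<in> Hom K B C"
    and "finite F" "F \<noteq> {}" "F \<subseteq> Hom K A B"
  shows "h \<cdot> (\<Squnion>\<^bsub>hom_poset K A B\<^esub> F) = \<Squnion>\<^bsub>hom_poset K A C\<^esub> ((\<lambda>f. h \<cdot> f) ` F)"
  using assms(3-5)
proof (induction F rule: finite_ne_induct)
  case (singleton f)
  then have f: "f \<in> Hom K A B" by simp
  interpret AB: upper_semilattice "hom_poset K A B"
    by (intro upper_semilattice_hom Hom_Obj[OF f])
  interpret AC: upper_semilattice "hom_poset K A C"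
    by (intro upper_semilattice_hom Hom_Obj[OF f] Hom_Obj[OF assms(2)])
  show ?case
    using AB.weak_sup_of_singleton[of f] AC.weak_sup_of_singleton[of "h \<cdot> f"] f Comp_Hom[OF f assms(2)]
    by simp
next
  case (insert f F)
  then have f: "f \<in> Hom K A B" and F: "F \<subseteq> Hom K A B" by auto
  interpret AB: upper_semilattice "hom_poset K A B"
    by (intro upper_semilattice_hom Hom_Obj[OF f])
  interpret AC: upper_semilattice "hom_poset K A C"
    by (intro upper_semilattice_hom Hom_Obj[OF f] Hom_Obj[OF assms(2)])
  have "\<Squnion>\<^bsub>hom_poset K A B\<^esub> F \<in> Hom K A B"
    using AB.finite_sup_closed[of F] insert.hyps F by simp
  then have "h \<cdot> (f \<squnion>\<^bsub>hom_poset K A B\<^esub> \<Squnion>\<^bsub>hom_poset K A B\<^esub> F) =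
      (h \<cdot> f) \<squnion>\<^bsub>hom_poset K A C\<^esub> (h \<cdot> (\<Squnion>\<^bsub>hom_poset K A B\<^esub> F))"
    using assms(1,2) f unfolding left_distributive_def by blast
  moreover have "(\<lambda>f. h \<cdot> f) ` F \<subseteq> Hom K A C" using F Comp_Hom[OF _ assms(2)] by blast
  ultimately show ?case
    using AB.finite_sup_insert[of F f] AC.finite_sup_insert[of "(\<lambda>f. h \<cdot> f) ` F" "h \<cdot> f"]
      insert.IH[OF F] insert.hyps f F Comp_Hom[OF f assms(2)]
    by simp
qed

text \<open>Finite subsets of an image are the images of finite subsets, so both sides can be
  indexed by the nonempty finite subsets of \<open>S\<close>. For each index the joins agree by
  \<open>Comp_finite_sup\<close>.\<close>

lemma finite_joins_Comp:
  assumes "left_distributive K" "h \<in> Hom K B C" "S \<subseteq> Hom K A B"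
  shows "finite_joins (hom_poset K A C) ((\<lambda>f. h \<cdot> f) ` S) =
    (\<lambda>f. h \<cdot> f) ` finite_joins (hom_poset K A B) S"
proof -
  have "\<Squnion>\<^bsub>hom_poset K A C\<^esub> ((\<lambda>f. h \<cdot> f) ` F) = h \<cdot> (\<Squnion>\<^bsub>hom_poset K A B\<^esub> F)"
    if "finite F" "F \<noteq> {}" "F \<subseteq> S" for F
    using Comp_finite_sup[OF assms(1,2) that(1,2)] that(3) assms(3) by simp
  moreover have "finite_joins (hom_poset K A C) ((\<lambda>f. h \<cdot> f) ` S) =
      (\<lambda>F. \<Squnion>\<^bsub>hom_poset K A C\<^esub> ((\<lambda>f. h \<cdot> f) ` F)) ` {F. finite F \<and> F \<noteq> {} \<and> F \<subseteq> S}"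
  proof -
    have "{G. finite G \<and> G \<noteq> {} \<and> G \<subseteq> (\<lambda>f. h \<cdot> f) ` S} =
        (\<lambda>F. (\<lambda>f. h \<cdot> f) ` F) ` {F. finite F \<and> F \<noteq> {} \<and> F \<subseteq> S}"
      using finite_subset_image[of _ "\<lambda>f. h \<cdot> f" S] by (auto 4 4 simp: image_iff)
    then show ?thesis
      unfolding finite_joins_def by (auto simp: setcompr_eq_image image_image)
  qed
  moreover have "finite_joins (hom_poset K A B) S =
      (\<lambda>F. \<Squnion>\<^bsub>hom_poset K A B\<^esub> F) ` {F. finite F \<and> F \<noteq> {} \<and> F \<subseteq> S}"
    unfolding finite_joins_def by (auto simp: setcompr_eq_image)
  ultimately show ?thesis by (auto simp: image_image intro!: image_cong)
qed

text \<open>Continuity moves \<open>h\<close> through the directed supremum, and left distributivity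
  moves it through the finite joins inside. Nonemptiness of \<open>S\<close> gives
  directedness.\<close>

lemma Comp_join_of:
  assumes "left_distributive K" "h \<in> Hom K B C" "S \<subseteq> Hom K A B" "S \<noteq> {}"
  shows "h \<cdot> join_of (hom_poset K A B) S = join_of (hom_poset K A C) ((\<lambda>f. h \<cdot> f) ` S)"
proof -
  obtain f where f: "f \<in> Hom K A B" using assms by blast
  interpret upper_semilattice "hom_poset K A B"
    by (intro upper_semilattice_hom Hom_Obj[OF f])
  have "directed_in (hom_poset K A B) (finite_joins (hom_poset K A B) S)"
    using assms by (intro directed_finite_joins) auto
  then show ?thesis
    using Comp_directed_sup_right assms(2) finite_joins_Comp[OF assms(1-3)]
    unfolding join_of_def by simp
qed

lemma join_of_Hom:
  assumes "S \<subseteq> Hom K A B" "S \<noteq> {}"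
  shows "join_of (hom_poset K A B) S \<in> Hom K A B"
    and "f \<in> S \<Longrightarrow> Leq K f (join_of (hom_poset K A B) S)"
proof -
  obtain g where g: "g \<in> Hom K A B" using assms by blast
  interpret upper_semilattice "hom_poset K A B"
    by (intro upper_semilattice_hom Hom_Obj[OF g])
  have lub: "least (hom_poset K A B) (join_of (hom_poset K A B) S)
      (Upper (hom_poset K A B) (finite_joins (hom_poset K A B) S))"
    unfolding join_of_def using assms by (intro least_directed_sup directed_finite_joins) auto
  then show "join_of (hom_poset K A B) S \<in> Hom K A B" using least_closed by fastforce
  show "Leq K f (join_of (hom_poset K A B) S)" if "f \<in> S"
    using least_Upper_above[OF lub, of f] finite_joins_superset[of S] finite_joins_closed[of S]
      that assms by auto
qed

section \<open>Powers of an endomorphism above the identity\<close>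

lemma endo_power_Hom:
  assumes "f \<in> Hom K X X"
  shows "endo_power K X f n \<in> Hom K X X"
  using assms by (induction n) (auto simp: endo_power_def intro: Ident_Hom Hom_Obj Comp_Hom)

lemma endo_power_Suc: "endo_power K X f (Suc n) = f \<cdot> endo_power K X f n"
  by (simp add: endo_power_def)

text \<open>\<open>endo_power\<close> adds factors on the left, whereas the fixed point equation
  composes with \<open>f\<close> on the right.\<close>

lemma endo_power_Suc_right:
  assumes "f \<in> Hom K X X"
  shows "endo_power K X f (Suc n) = endo_power K X f n \<cdot> f"
proof (induction n)
  case 0
  show ?case using assms by (simp add: endo_power_def Comp_Ident Ident_Comp)
next
  case (Suc n)
  then show ?case
    using Comp_assoc[OF assms endo_power_Hom[OF assms] assms, of n]
    by (simp add: endo_power_Suc)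
qed

lemma endo_power_mono:
  assumes "f \<in> Hom K X X" "Leq K (Ident K X) f" "m \<le> n"
  shows "Leq K (endo_power K X f m) (endo_power K X f n)"
proof -
  interpret partial_order "hom_poset K X X"
    by (intro hom_partial_order Hom_Obj[OF assms(1)])
  note pow = endo_power_Hom[OF assms(1)]
  note Id = Ident_Hom[OF Hom_Obj(1)[OF assms(1)]]
  show ?thesis
    using assms(3)
  proof (induction n rule: dec_induct)
    case base
    show ?case using le_refl[of "endo_power K X f m"] pow by simp
  next
    case (step n)
    have "Leq K (Ident K X \<cdot> endo_power K X f n) (f \<cdot> endo_power K X f n)"
      by (rule Comp_mono) (use pow Id assms le_refl[of "endo_power K X f n"] in auto)
    then have "Leq K (endo_power K X f n) (endo_power K X f (Suc n))"
      using Ident_Comp[OF pow] by (simp add: endo_power_Suc)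
    then show ?case using step le_trans[of _ "endo_power K X f n"] pow by auto
  qed
qed

text \<open>Since the identity lies below \<open>f\<close>, the Kleene iterates of the map, started
  at the identity, are just the powers of \<open>f\<close>. Only a directed supremum then has to
  pass through composition with \<open>f\<close> on the right.\<close>

lemma least_fixed_point_sup_endo_power:
  assumes f: "f \<in> Hom K X X" and ge: "Leq K (Ident K X) f"
  shows "least (hom_poset K X X) (\<Squnion>\<^bsub>hom_poset K X X\<^esub> (range (endo_power K X f)))
    (fps (hom_poset K X X) (\<lambda>x. Ident K X \<squnion>\<^bsub>hom_poset K X X\<^esub> x \<cdot> f))"
proof -
  let ?L = "hom_poset K X X" and ?p = "endo_power K X f"
  let ?S = "\<Squnion>\<^bsub>?L\<^esub> (range ?p)"
  interpret upper_semilattice ?L by (intro upper_semilattice_hom Hom_Obj[OF f])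
  note Id = Ident_Hom[OF Hom_Obj(1)[OF f]]
  note pow = endo_power_Hom[OF f]
  note refl = le_refl[simplified]
  note trans = le_trans[simplified]
  have dir: "directed_in ?L (range ?p)"
    unfolding directed_in_def
    using pow by (auto intro: endo_power_mono[OF f ge] max.cobounded1 max.cobounded2)
  have lub: "least ?L ?S (Upper ?L (range ?p))" by (rule least_directed_sup[OF dir])
  have S: "?S \<in> Hom K X X" using least_closed[OF lub] by simp
  have pow_le: "Leq K (?p n) ?S" for n
    using least_Upper_above[OF lub, of "?p n"] pow by auto
  have S_le: "Leq K ?S x" if "x \<in> Hom K X X" "\<And>n. Leq K (?p n) x" for x
    using least_le[OF lub, of x] that by (auto simp: Upper_def)
  \<comment> \<open>Composing the chain with \<open>f\<close> on the right only shifts its index by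
    one.\<close>
  have Sf: "?S \<cdot> f = \<Squnion>\<^bsub>?L\<^esub> (range (\<lambda>n. ?p (Suc n)))"
    using Comp_directed_sup_left[OF f dir]
    by (simp add: image_image endo_power_Suc_right[OF f])
  have dir': "directed_in ?L (range (\<lambda>n. ?p (Suc n)))"
    unfolding directed_in_def
  proof (intro conjI ballI)
    fix x y assume "x \<in> range (\<lambda>n. ?p (Suc n))" "y \<in> range (\<lambda>n. ?p (Suc n))"
    then obtain m n where "x = ?p (Suc m)" "y = ?p (Suc n)" by blast
    then show "\<exists>z\<in>range (\<lambda>n. ?p (Suc n)). x \<sqsubseteq>\<^bsub>?L\<^esub> z \<and> y \<sqsubseteq>\<^bsub>?L\<^esub> z"
      by (intro bexI[of _ "?p (Suc (max m n))"]) (auto intro: endo_power_mono[OF f ge])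
  qed (use pow in auto)
  have lub': "least ?L (?S \<cdot> f) (Upper ?L (range (\<lambda>n. ?p (Suc n))))"
    unfolding Sf by (rule least_directed_sup[OF dir'])
  have SfH: "?S \<cdot> f \<in> Hom K X X" using f S by (rule Comp_Hom)
  \<comment> \<open>The shifted chain starts at exponent 1, but every power lies below its
    successor, so the supremum does not shrink.\<close>
  have "Leq K (?p n) (?S \<cdot> f)" for n
  proof -
    have "Leq K (?p (Suc n)) (?S \<cdot> f)" using least_Upper_above[OF lub', of "?p (Suc n)"] pow by auto
    moreover have "Leq K (?p n) (?p (Suc n))" by (rule endo_power_mono[OF f ge]) simp
    ultimately show ?thesis using pow SfH trans by blast
  qed
  then have "Leq K ?S (?S \<cdot> f)" by (intro S_le SfH)
  moreover have "Leq K (?S \<cdot> f) ?S"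
    using least_le[OF lub', of ?S] S pow_le by (auto simp: Upper_def)
  ultimately have S_fixed: "?S \<cdot> f = ?S" using le_antisym[simplified] S SfH by blast
  have IdS: "Leq K (Ident K X) ?S" using pow_le[of 0] by (simp add: endo_power_def)
  have "Ident K X \<squnion>\<^bsub>?L\<^esub> ?S = ?S"
    using le_antisym[of "Ident K X \<squnion>\<^bsub>?L\<^esub> ?S" ?S] join_le[of "Ident K X" ?S ?S]
      join_right[of "Ident K X" ?S] join_closed[of "Ident K X" ?S] IdS S Id refl[OF S]
    by simp
  then have "?S \<in> fps ?L (\<lambda>x. Ident K X \<squnion>\<^bsub>?L\<^esub> x \<cdot> f)" using S S_fixed by (simp add: fps_def)
  moreover have "Leq K ?S x" if "x \<in> fps ?L (\<lambda>x. Ident K X \<squnion>\<^bsub>?L\<^esub> x \<cdot> f)" for x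
  proof (rule S_le)
    from that show x: "x \<in> Hom K X X" by (simp add: fps_def)
    then have xf: "x \<cdot> f \<in> Hom K X X" using f by (intro Comp_Hom)
    have eq: "Ident K X \<squnion>\<^bsub>?L\<^esub> x \<cdot> f = x" using that by (simp add: fps_def)
    have Idx: "Leq K (Ident K X) x" and xfx: "Leq K (x \<cdot> f) x"
      using join_left[of "Ident K X" "x \<cdot> f"] join_right[of "Ident K X" "x \<cdot> f"] Id xf eq by auto
    \<comment> \<open>As \<open>x \<cdot> f\<close> lies below \<open>x\<close>, the factors of a
      power can be absorbed into \<open>x\<close> one at a time, beginning with the
      leftmost.\<close>
    have xp: "Leq K (x \<cdot> ?p n) x" for n
    proof (induction n)
      case 0
      show ?case using refl[OF x] Comp_Ident[OF x] by (simp add: endo_power_def)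
    next
      case (Suc n)
      have "Leq K ((x \<cdot> f) \<cdot> ?p n) (x \<cdot> ?p n)"
        by (rule Comp_mono) (use pow xf x xfx refl in auto)
      then show ?case
        using trans[OF _ Suc] x pow xf
        by (simp add: endo_power_Suc Comp_assoc[OF pow f x] Comp_Hom[OF pow] Comp_Hom[OF Comp_Hom[OF pow f]])
    qed
    fix n
    \<comment> \<open>The identity lies below \<open>x\<close>, so each power lies below
      \<open>x \<cdot> ?p n\<close>, which \<open>xp\<close> bounds by \<open>x\<close>.\<close>
    have "Leq K (Ident K X \<cdot> ?p n) (x \<cdot> ?p n)"
      by (rule Comp_mono) (use pow Id x Idx refl in auto)
    then show "Leq K (?p n) x"
      using trans[OF _ xp] Ident_Comp[OF pow] Comp_Hom[OF pow x] pow x by simp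
  qed
  ultimately show ?thesis by (auto simp: least_def fps_def)
qed

end

section \<open>The saturation\<close>

theorem theorem3p17:
  fixes D :: "('d, 'e) category"
    and K :: "('o, 'm) ord_category"
    and J :: "('o, 'm) category"
    and \<pi> :: "('d, 'e, 'o, 'm) functor_data"
    and X :: 'o and \<iota> :: "'d \<Rightarrow> 'm"
  assumes "category D"
    and "order_enriched_category K"
    and "subcategory J K" and "Obj J = Obj K"
    and "has_coproducts J (Obj D)" and "has_coproducts K (Obj D)"
    and "inclusion_preserves_coproducts J K (Obj D)"
    and "dcpo_join_enriched_category K"
    and "left_distributive K"
    and "cotupling_preserves_order K (Obj D)"
    and "lax_functor D K \<pi>"
    and "is_coproduct K (Obj D) (FObj \<pi>) X \<iota>"
  shows "least (hom_poset K X X) (Sigma_bang D K \<pi> X \<iota>)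
           (fps (hom_poset K X X)
              (\<lambda>x. Ident K X \<squnion>\<^bsub>hom_poset K X X\<^esub>
                 join_of (hom_poset K X X) ((\<lambda>d. x \<cdot>\<^bsub>K\<^esub> lift_arr D K \<pi> X \<iota> d) ` Arr D)))"
proof -
  interpret D: category D by fact
  interpret K: dcpo_join_enriched_category K by fact
  let ?L = "hom_poset K X X" and ?l = "lift_arr D K \<pi> X \<iota>"
  \<comment> \<open>This is the supremum of \<open>Pi_set\<close>, which consists of the very finite
    joins from which \<open>join_of\<close> is formed. Its powers are thus those in
    \<open>Sigma_bang\<close>.\<close>
  define P where "P = join_of ?L (?l ` Arr D)"
  note cop = \<open>is_coproduct K (Obj D) (FObj \<pi>) X \<iota>\<close>
  note lax = \<open>lax_functor D K \<pi>\<close>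
  note ldist = \<open>left_distributive K\<close>
  have X: "X \<in> Obj K" and \<iota>: "\<And>A. A \<in> Obj D \<Longrightarrow> \<iota> A \<in> Hom K (FObj \<pi> A) X"
    using cop unfolding is_coproduct_def by auto
  interpret upper_semilattice ?L by (intro K.upper_semilattice_hom X)
  note Id = K.Ident_Hom[OF X]
  have fam: "(if A = Dom D d then \<iota> (Cod D d) \<cdot>\<^bsub>K\<^esub> FArr \<pi> d else \<iota> A) \<in> Hom K (FObj \<pi> A) X"
    if "A \<in> Obj D" "d \<in> Arr D" for A d
    using that lax \<iota> D.Cod_Obj[OF that(2)] unfolding lax_functor_def
    by (auto intro: K.Comp_Hom)
  have l: "?l ` Arr D \<subseteq> Hom K X X"
    unfolding lift_arr_def using fam by (auto intro!: cotuple_Hom[OF cop X])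
  have "P \<in> Hom K X X \<and> Leq K (Ident K X) P \<and>
      (\<forall>x\<in>Hom K X X. join_of ?L ((\<lambda>d. x \<cdot>\<^bsub>K\<^esub> ?l d) ` Arr D) = x \<cdot>\<^bsub>K\<^esub> P)"
  proof (cases "Obj D = {}")
    case True
    then have D: "Arr D = {}" using D.Dom_Obj by blast
    \<comment> \<open>Over an empty index set the uniqueness clause of the coproduct carries no
      condition, so it identifies all endomorphisms.\<close>
    have H: "x = Ident K X" if "x \<in> Hom K X X" for x
      using is_coproduct_Ex1[OF cop X] True Id that by auto
    \<comment> \<open>An empty supremum is a least element; one must be exhibited before the choice
      in \<open>sup\<close> can be evaluated.\<close>
    have "least ?L (Ident K X) (Upper ?L {})"
      using Id le_refl[of "Ident K X"] by (auto simp: least_def dest: H)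
    then have "least ?L (\<Squnion>\<^bsub>?L\<^esub> {}) (Upper ?L {})" by (intro least_sup exI)
    then have "\<Squnion>\<^bsub>?L\<^esub> {} \<in> Hom K X X" using least_closed by force
    then have J: "join_of ?L {} = Ident K X"
      using H unfolding join_of_def finite_joins_def by auto
    then have "P = Ident K X" using D by (simp add: P_def)
    moreover have "x \<cdot>\<^bsub>K\<^esub> Ident K X = Ident K X" if "x \<in> Hom K X X" for x
      using H[OF that] K.Comp_Ident[OF that] by simp
    ultimately show ?thesis using D J Id le_refl[of "Ident K X"] by simp
  next
    case False
    \<comment> \<open>Any object will do: the lift of a single identity arrow already lies above the
      identity of \<open>X\<close>.\<close>
    then obtain A where A: "A \<in> Obj D" by blast
    let ?e = "Ident D A"
    have e: "?e \<in> Arr D" "Dom D ?e = A" "Cod D ?e = A"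
      using D.Ident_Hom[OF A] unfolding Hom_def by auto
    \<comment> \<open>The two families differ at most at \<open>A\<close>. There, composing the lax
      unit inequality with the coprojection gives the bound; elsewhere it is reflexivity.\<close>
    have "Leq K (\<iota> B) (if B = Dom D ?e then \<iota> (Cod D ?e) \<cdot>\<^bsub>K\<^esub> FArr \<pi> ?e else \<iota> B)"
      if B: "B \<in> Obj D" for B
    proof (cases "B = A")
      case True
      have FA: "FObj \<pi> A \<in> Obj K" "FArr \<pi> ?e \<in> Hom K (FObj \<pi> A) (FObj \<pi> A)"
        "Leq K (Ident K (FObj \<pi> A)) (FArr \<pi> ?e)"
        using lax A e unfolding lax_functor_def by metis+
      interpret A: partial_order "hom_poset K (FObj \<pi> A) X"
        by (intro K.hom_partial_order FA X)
      have "Leq K (\<iota> A \<cdot>\<^bsub>K\<^esub> Ident K (FObj \<pi> A)) (\<iota> A \<cdot>\<^bsub>K\<^esub> FArr \<pi> ?e)"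
        by (rule K.Comp_mono)
          (use FA \<iota>[OF A] K.Ident_Hom[OF FA(1)] A.le_refl[of "\<iota> A"] in auto)
      then show ?thesis using True e K.Comp_Ident[OF \<iota>[OF A]] by simp
    next
      case False
      interpret B: partial_order "hom_poset K (FObj \<pi> B) X"
        by (intro K.hom_partial_order K.Hom_Obj[OF \<iota>[OF B]])
      show ?thesis using False e B.le_refl[of "\<iota> B"] \<iota>[OF B] by simp
    qed
    then have "Leq K (cotuple K (Obj D) X \<iota> X \<iota>) (?l ?e)"
      unfolding lift_arr_def
      by (intro cotuple_mono[OF \<open>cotupling_preserves_order K (Obj D)\<close> cop X] \<iota> fam e(1))
    then have Id_le: "Leq K (Ident K X) (?l ?e)" by (simp add: K.cotuple_coprojections[OF cop])
    have ne: "?l ` Arr D \<noteq> {}" using e by blast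
    have P: "P \<in> Hom K X X" "Leq K (?l ?e) P"
      unfolding P_def using K.join_of_Hom[OF l ne] e by auto
    have "Leq K (Ident K X) P"
      using le_trans[of "Ident K X" "?l ?e" P] Id_le P Id l e by auto
    moreover have "join_of ?L ((\<lambda>d. x \<cdot>\<^bsub>K\<^esub> ?l d) ` Arr D) = x \<cdot>\<^bsub>K\<^esub> P" if "x \<in> Hom K X X" for x
      using K.Comp_join_of[OF ldist that l ne] unfolding P_def by (simp add: image_image)
    ultimately show ?thesis using P by blast
  qed
  then have P: "P \<in> Hom K X X" "Leq K (Ident K X) P"
    and J: "\<And>x. x \<in> Hom K X X \<Longrightarrow> join_of ?L ((\<lambda>d. x \<cdot>\<^bsub>K\<^esub> ?l d) ` Arr D) = x \<cdot>\<^bsub>K\<^esub> P"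
    by auto
  \<comment> \<open>Members of \<open>fps\<close> lie in the carrier, so \<open>J\<close>, which
    speaks of endomorphisms of \<open>X\<close> only, applies to each candidate.\<close>
  have "fps ?L (\<lambda>x. Ident K X \<squnion>\<^bsub>?L\<^esub> join_of ?L ((\<lambda>d. x \<cdot>\<^bsub>K\<^esub> ?l d) ` Arr D)) =
      fps ?L (\<lambda>x. Ident K X \<squnion>\<^bsub>?L\<^esub> x \<cdot>\<^bsub>K\<^esub> P)"
    using J by (auto simp: fps_def)
  then show ?thesis
    using K.least_fixed_point_sup_endo_power[OF P]
    by (simp add: Sigma_bang_def Pi_set_def P_def join_of_def)
qed

end
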